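(* There are uncountably many distinct flow-periodic flexes of the kagome framework. Precisely: there are vertices $v_i,v_j,v_k$ of the kagome framework $\mathcal{G}_{kag}=(G,p)$, with $v_iv_j$ and $v_jv_k$ edges, and an uncountable family of pairwise different base-fixed two-sided continuous flexes of $\mathcal{G}_{kag}$, each flow-periodic, all having the same motions of $v_i,v_j,v_k$, and such that $g(t)=\langle p_i(t)-p_j(t),p_k(t)-p_j(t)\rangle$ is strictly monotone on $[-1,1]$.
   Context: The kagome framework $\mathcal{G}_{kag}=(G,p)$ in $\mathbb{R}^2$ is the bar-joint framework of corner-joined congruent equilateral triangles in regular hexagonal arrangement. Explicitly, with $a_1=(1,0)$, $a_2=(1/2,\sqrt3/2)$, its framework points are the translates by $\mathbb{Z}a_1+\mathbb{Z}a_2$ of $p_1=(0,0)$, $p_2=(1/2,0)$, $p_3=(1/4,\sqrt3/4)$, and its edges join the points at distance $1/2$. A base-fixed two-sided continuous flex is $p(t)=(p_v(t))_v$, $t\in[-1,1]$, with $p(0)=p$, each $p_v(t)$ continuous, all edge lengths $|p_v(t)-p_w(t)|$ constant in $t$, the two endpoints of some edge constant in $t$, and $p(t)\neq p$ for some $t$. An affine flow is a pointwise continuous path $t\mapsto A_t$ of invertible affine transformations of $\mathbb{R}^2$. A flex $p(t)$ is flow-periodic, relative to the flow and a nontrivial (possibly rank one) subgroup $\mathcal{T}=\{T_g:g\in\mathcal D\}$ of the translation group of the framework, if for each $t$ the framework $(G,p(t))$ is periodic for $\mathcal{T}^t=\{A_tT_gA_t^{-1}: g\in\mathcal D\}$,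 i.e. $p_{gv}(t)=A_tT_gA_t^{-1}p_v(t)$ for all $v$ and $g\in\mathcal D$. *)

theory Defs
  imports "HOL-Analysis.Analysis" "HOL-Algebra.Elementary_Groups"
begin

definition a1 :: "real ^ 2" where "a1 = vector [1, 0]"
definition a2 :: "real ^ 2" where "a2 = vector [1/2, sqrt 3 / 2]"

datatype site = S1 | S2 | S3

fun site_point :: "site \<Rightarrow> real ^ 2" where
  "site_point S1 = vector [0, 0]"
| "site_point S2 = vector [1/2, 0]"
| "site_point S3 = vector [1/4, sqrt 3 / 4]"

text \<open>The vertex \<open>((m, n), s)\<close> is the translate of the site \<open>s\<close> by \<open>m a1 + n a2\<close>.\<close>

type_synonym kvertex = "(int \<times> int) \<times> site"

definition lattice_vec :: "int \<times> int \<Rightarrow> real ^ 2" where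
  "lattice_vec g = of_int (fst g) *\<^sub>R a1 + of_int (snd g) *\<^sub>R a2"

definition kagome_point :: "kvertex \<Rightarrow> real ^ 2" where
  "kagome_point v = site_point (snd v) + lattice_vec (fst v)"

definition kagome_edge :: "kvertex \<Rightarrow> kvertex \<Rightarrow> bool" where
  "kagome_edge v w \<longleftrightarrow> dist (kagome_point v) (kagome_point w) = 1/2"

definition translation :: "int \<times> int \<Rightarrow> real ^ 2 \<Rightarrow> real ^ 2" where
  "translation g x = x + lattice_vec g"

definition shift_vertex :: "int \<times> int \<Rightarrow> kvertex \<Rightarrow> kvertex" where
  "shift_vertex g v = ((fst g + fst (fst v), snd g + snd (fst v)), snd v)"

text \<open>A path of placements is a total function of time; only its values on \<open>[-1, 1]\<close> are
  constrained.  Two such functions represent different flexes only if they differ at some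
  time in \<open>[-1, 1]\<close>.\<close>

definition base_fixed_flex ::
  "('v \<Rightarrow> 'v \<Rightarrow> bool) \<Rightarrow> ('v \<Rightarrow> real ^ 2) \<Rightarrow> (real \<Rightarrow> 'v \<Rightarrow> real ^ 2) \<Rightarrow> bool" where
  "base_fixed_flex E p P \<longleftrightarrow>
     P 0 = p \<and>
     (\<forall>v. continuous_on {-1..1} (\<lambda>t. P t v)) \<and>
     (\<forall>v w. E v w \<longrightarrow> (\<forall>t\<in>{-1..1}. dist (P t v) (P t w) = dist (p v) (p w))) \<and>
     (\<exists>v w. E v w \<and> (\<forall>t\<in>{-1..1}. P t v = p v \<and> P t w = p w)) \<and>
     (\<exists>t\<in>{-1..1}. P t \<noteq> p)"

definition different_flexes ::
  "(real \<Rightarrow> 'v \<Rightarrow> real ^ 2) \<Rightarrow> (real \<Rightarrow> 'v \<Rightarrow> real ^ 2) \<Rightarrow> bool" where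
  "different_flexes P Q \<longleftrightarrow> (\<exists>t\<in>{-1..1}. P t \<noteq> Q t)"

definition invertible_affine :: "(real ^ 2 \<Rightarrow> real ^ 2) \<Rightarrow> bool" where
  "invertible_affine f \<longleftrightarrow> bij f \<and> (\<exists>L c. linear L \<and> f = (\<lambda>x. L x + c))"

definition affine_flow :: "(real \<Rightarrow> real ^ 2 \<Rightarrow> real ^ 2) \<Rightarrow> bool" where
  "affine_flow A \<longleftrightarrow>
     (\<forall>t\<in>{-1..1}. invertible_affine (A t)) \<and> (\<forall>x. continuous_on {-1..1} (\<lambda>t. A t x))"

definition flow_periodic_wrt ::
  "(real \<Rightarrow> real ^ 2 \<Rightarrow> real ^ 2) \<Rightarrow> (int \<times> int) set \<Rightarrow> (real \<Rightarrow> kvertex \<Rightarrow> real ^ 2) \<Rightarrow> bool" where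
  "flow_periodic_wrt A D P \<longleftrightarrow>
     (\<forall>t\<in>{-1..1}. \<forall>v. \<forall>g\<in>D. P t (shift_vertex g v) = (A t \<circ> translation g \<circ> inv_into UNIV (A t)) (P t v))"

definition flow_periodic :: "(real \<Rightarrow> kvertex \<Rightarrow> real ^ 2) \<Rightarrow> bool" where
  "flow_periodic P \<longleftrightarrow>
     (\<exists>A D. affine_flow A \<and> subgroup D (integer_group \<times>\<times> integer_group) \<and> D \<noteq> {(0, 0)} \<and>
            flow_periodic_wrt A D P)"

end

theory Submission
  imports Defs
begin

text \<open>
  The kagome framework consists of "up" triangles, one for each lattice cell, and "down"
  triangles, which fill the gaps between neighbouring cells; the up and down triangles with
  a side on the same horizontal line form a zigzag chain.  If along such a chain one of the two
  kinds of triangle is merely translated while the other one turns through the angle \<open>t\<close>, then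
  consecutive triangles of the same kind are displaced by \<open>(a1 + rot t a1) / 2\<close>, because the
  chain alternates unturned and turned edges.  This vector does not depend on which
  of the two kinds turns.  The chains above and below a given one only see it through its
  equally spaced apexes, so the choice of the turning kind can be made independently in
  each row, and every choice gives a flex.  There are uncountably many choices.

  A closed formula exists for this.  Let \<open>S\<close> be the set of rows whose up triangles turn, and let
  \<open>mean_rot t\<close> be the average of the identity and \<open>rot t\<close>.  The apex of each up triangle moves
  by the linear map \<open>mean_rot t\<close> (relative to a fixed origin), and the up triangle itself turns
  about this apex through \<open>t\<close> if its row is in \<open>S\<close>, and through \<open>0\<close> otherwise; this is
  \<open>row_flex S t\<close>.  Differences of two vertices within a down triangle are then transformed by
  twice the average minus the motion of the up triangles, hence by the other one of the two
  motions, which is again an isometry (\<open>row_flex_diff_up\<close>, \<open>row_flex_diff_down\<close>).  Since every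
  edge lies in an up or a down triangle (\<open>kagome_edge_same_triangle\<close>), all edge lengths are
  preserved.

  The flex is periodic under horizontal translations, with the flow \<open>mean_rot t\<close>, which is
  invertible as long as \<open>cos t > -1\<close>.  If \<open>0 \<notin> S\<close>, then the up triangle at the origin is fixed
  and the down triangle that shares its vertex at the origin turns through \<open>t\<close>, independently of
  \<open>S\<close>.  These two triangles contribute two consecutive sides of a hexagon, and the angle between
  them gives the monotone inner product (\<open>row_flex_angle\<close>).
\<close>

section \<open>Rotations and the averaged flow\<close>

definition rot :: "real \<Rightarrow> real ^ 2 \<Rightarrow> real ^ 2" where
  "rot t x = vector [cos t * x $ 1 - sin t * x $ 2, sin t * x $ 1 + cos t * x $ 2]"

lemma linear_rot: "linear (rot t)"
  by (rule linearI) (simp_all add: rot_def vec_eq_iff forall_2 algebra_simps)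

lemma rot_zero [simp]: "rot 0 x = x"
  by (simp add: rot_def vec_eq_iff forall_2)

lemma inner_rot: "rot t x \<bullet> rot t y = x \<bullet> y"
proof -
  have "rot t x \<bullet> rot t y = ((cos t)\<^sup>2 + (sin t)\<^sup>2) * (x $ 1 * y $ 1 + x $ 2 * y $ 2)"
    by (simp add: rot_def inner_vec_def sum_2 power2_eq_square algebra_simps
        del: sin_cos_squared_add3)
  then show ?thesis
    by (simp add: inner_vec_def sum_2)
qed

lemma norm_rot [simp]: "norm (rot t x) = norm x"
  by (simp add: norm_eq_sqrt_inner inner_rot)

lemma continuous_on_rot [continuous_intros]: "continuous_on T (\<lambda>t. rot t x)"
proof -
  have "rot t x = cos t *\<^sub>R x + sin t *\<^sub>R vector [- x $ 2, x $ 1]" for t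
    by (simp add: rot_def vec_eq_iff forall_2)
  then show ?thesis
    by (auto intro!: continuous_intros)
qed

text \<open>The flow by which the rank-one translation group is deformed.  It is \<open>cos (t/2)\<close> times the
  rotation by \<open>t/2\<close>.\<close>

definition mean_rot :: "real \<Rightarrow> real ^ 2 \<Rightarrow> real ^ 2" where
  "mean_rot t x = (1/2) *\<^sub>R (x + rot t x)"

lemma linear_mean_rot: "linear (mean_rot t)"
  using linear_add[OF linear_rot] linear_scale[OF linear_rot]
  by (intro linearI) (simp_all add: mean_rot_def algebra_simps)

lemma inner_rot_self: "x \<bullet> rot t x = cos t * (x \<bullet> x)"
  by (simp add: rot_def inner_vec_def sum_2 algebra_simps)

text \<open>A kernel vector \<open>x\<close> would satisfy \<open>rot t x = - x\<close>, whereas the inner product of \<open>x\<close> with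
  \<open>rot t x\<close> is positive for nonzero \<open>x\<close>.\<close>

lemma bij_mean_rot:
  assumes "cos t > 0"
  shows "bij (mean_rot t)"
proof -
  have "x = 0" if "mean_rot t x = 0" for x
  proof -
    have "0 = x \<bullet> (2 *\<^sub>R mean_rot t x)"
      using that by simp
    also have "\<dots> = (1 + cos t) * (x \<bullet> x)"
      by (simp add: mean_rot_def inner_add_right inner_rot_self algebra_simps)
    finally show "x = 0"
      using assms by simp
  qed
  then have "inj (mean_rot t)"
    by (simp add: linear_injective_0[OF linear_mean_rot])
  then show ?thesis
    using linear_injective_imp_surjective[OF linear_mean_rot] by (simp add: bij_def)
qed

lemma affine_flow_mean_rot: "affine_flow mean_rot"
  unfolding affine_flow_def
proof (intro conjI ballI allI)
  fix t :: real assume "t \<in> {-1..1}"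
  then have "cos t > 0"
    using pi_gt3 by (intro cos_gt_zero_pi) auto
  then show "invertible_affine (mean_rot t)"
    unfolding invertible_affine_def
    using bij_mean_rot linear_mean_rot by (metis add.right_neutral)
next
  fix x show "continuous_on {-1..1} (\<lambda>t. mean_rot t x)"
    unfolding mean_rot_def by (intro continuous_intros)
qed

lemma lattice_vec_add: "lattice_vec (g + h) = lattice_vec g + lattice_vec h"
  by (simp add: lattice_vec_def algebra_simps)

lemma mean_rot_conj_translation:
  assumes "cos t > 0"
  shows "(mean_rot t \<circ> translation g \<circ> inv_into UNIV (mean_rot t)) x = x + mean_rot t (lattice_vec g)"
  using bij_mean_rot[OF assms]
  by (simp add: translation_def linear_add[OF linear_mean_rot] bij_is_surj surj_f_inv_f)

section \<open>The row flexes\<close>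

lemma site_point_lattice [simp]:
  "site_point S1 = 0" "site_point S2 = (1/2) *\<^sub>R a1" "site_point S3 = (1/2) *\<^sub>R a2"
  by (simp_all add: a1_def a2_def vec_eq_iff forall_2)

declare site_point.simps [simp del]

definition up_motion :: "int set \<Rightarrow> real \<Rightarrow> int \<Rightarrow> real ^ 2 \<Rightarrow> real ^ 2" where
  "up_motion S t n = (if n \<in> S then rot t else id)"

definition down_motion :: "int set \<Rightarrow> real \<Rightarrow> int \<Rightarrow> real ^ 2 \<Rightarrow> real ^ 2" where
  "down_motion S t n = (if n \<in> S then id else rot t)"

text \<open>The site \<open>S3\<close> is the apex of the up triangle of its cell; the triangle turns about it.\<close>

definition row_flex :: "int set \<Rightarrow> real \<Rightarrow> kvertex \<Rightarrow> real ^ 2" where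
  "row_flex S t v = mean_rot t (lattice_vec (fst v)) + site_point S3
     + up_motion S t (snd (fst v)) (site_point (snd v) - site_point S3)"

lemma linear_up_motion: "linear (up_motion S t n)"
  by (simp add: up_motion_def linear_rot linear_id)

lemma linear_down_motion: "linear (down_motion S t n)"
  by (simp add: down_motion_def linear_rot linear_id)

lemma norm_up_motion [simp]: "norm (up_motion S t n x) = norm x"
  by (simp add: up_motion_def)

lemma norm_down_motion [simp]: "norm (down_motion S t n x) = norm x"
  by (simp add: down_motion_def)

text \<open>The average of the motions of the two kinds of triangle is the same in all rows; this is
  what lets rows with different choices fit together.\<close>

lemma up_motion_add_down_motion:
  "up_motion S t n x + down_motion S t n x = 2 *\<^sub>R mean_rot t x"
  by (simp add: up_motion_def down_motion_def mean_rot_def)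

text \<open>The down triangle containing a vertex, labelled by the cell of the \<open>S1\<close> vertex of that
  triangle.\<close>

fun down_cell :: "kvertex \<Rightarrow> int \<times> int" where
  "down_cell (g, S1) = g"
| "down_cell (g, S2) = g + (1, 0)"
| "down_cell (g, S3) = g + (0, 1)"

lemma row_flex_diff_up:
  assumes "fst v = fst w"
  shows "row_flex S t v - row_flex S t w
    = up_motion S t (snd (fst v)) (kagome_point v - kagome_point w)"
  using assms by (simp add: row_flex_def kagome_point_def flip: linear_diff[OF linear_up_motion])

text \<open>The flex described from the point of view of the down triangles: they too turn about
  their apexes, which are the apexes of the up triangles one row below.  This accounts for the
  terms \<open>a2\<close>.  At the apex itself the argument of \<open>down_motion\<close> is zero, so it does not matter
  that the row of the down triangle differs from the row of the cell containing its apex.\<close>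

lemma row_flex_via_down:
  "row_flex S t v = mean_rot t (lattice_vec (down_cell v)) + site_point S3 - mean_rot t a2
    + down_motion S t (snd (down_cell v))
        (kagome_point v - lattice_vec (down_cell v) + site_point S3)"
proof -
  have D: "down_motion S t n x = 2 *\<^sub>R mean_rot t x - up_motion S t n x" for n x
    using up_motion_add_down_motion[of S t n x] by (simp add: algebra_simps)
  have e: "lattice_vec (1, 0) = a1" "lattice_vec (0, 1) = a2"
    by (simp_all add: lattice_vec_def)
  note lin = linear_add linear_diff linear_scale linear_neg linear_0
  note lin' = lin[OF linear_mean_rot] lin[OF linear_up_motion]
  show ?thesis
    by (cases v rule: down_cell.cases;
        simp add: row_flex_def kagome_point_def D lattice_vec_add e lin';
        simp add: vec_eq_iff)
qed

lemma row_flex_diff_down: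
  assumes "down_cell v = down_cell w"
  shows "row_flex S t v - row_flex S t w
    = down_motion S t (snd (down_cell v)) (kagome_point v - kagome_point w)"
  unfolding row_flex_via_down[of S t v] row_flex_via_down[of S t w] assms
  by (simp add: algebra_simps flip: linear_diff[OF linear_down_motion])

section \<open>Edges lie in triangles\<close>

text \<open>Coordinates of the sites in the basis \<open>a1/2\<close>, \<open>a2/2\<close>, in which all framework points are
  integral and the edges become the solutions of a quadratic equation over the integers.\<close>

fun half_coords :: "site \<Rightarrow> int \<times> int" where
  "half_coords S1 = (0, 0)"
| "half_coords S2 = (1, 0)"
| "half_coords S3 = (0, 1)"

lemma norm_half_lattice:
  "(norm ((of_int i / 2) *\<^sub>R a1 + (of_int j / 2) *\<^sub>R a2))\<^sup>2 = of_int (i * i + i * j + j * j) / 4"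
  by (simp add: power2_norm_eq_inner inner_vec_def sum_2 a1_def a2_def field_simps)

text \<open>These are the six units of the ring of Eisenstein integers.  The bounds come from completing
  the square, \<open>4 * (i * i + i * j + j * j) = (2 * i + j)\<^sup>2 + 3 * j\<^sup>2\<close>, and symmetrically
  in \<open>i\<close>.\<close>

lemma unit_eisenstein:
  fixes i j :: int
  assumes "i * i + i * j + j * j = 1"
  shows "(i, j) \<in> {(1, 0), (-1, 0), (0, 1), (0, -1), (1, -1), (-1, 1)}"
proof -
  have "3 * (j * j) \<le> (2 * i + j) * (2 * i + j) + 3 * (j * j)"
       "3 * (i * i) \<le> (2 * j + i) * (2 * j + i) + 3 * (i * i)"
    by simp_all
  then have "3 * (j * j) \<le> 4" "3 * (i * i) \<le> 4"
    using assms by (simp_all add: algebra_simps)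
  then have "\<bar>j\<bar>\<^sup>2 < 2\<^sup>2" "\<bar>i\<bar>\<^sup>2 < 2\<^sup>2"
    by (simp_all add: power2_eq_square)
  then have "\<bar>i\<bar> < 2" "\<bar>j\<bar> < 2"
    using power2_less_imp_less by fastforce+
  then have "i \<in> {-1, 0, 1}" "j \<in> {-1, 0, 1}"
    by auto
  then show ?thesis
    using assms by auto
qed

text \<open>The six unit steps in half coordinates, combined with the parities that distinguish the
  sites, leave only pairs of sites in one triangle.\<close>

lemma kagome_edge_same_triangle:
  assumes "kagome_edge v w"
  shows "fst v = fst w \<or> down_cell v = down_cell w"
proof -
  obtain m n s where v: "v = ((m, n), s)" by (metis surj_pair)
  obtain m' n' s' where w: "w = ((m', n'), s')" by (metis surj_pair)
  define i where "i = 2 * (m - m') + fst (half_coords s) - fst (half_coords s')"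
  define j where "j = 2 * (n - n') + snd (half_coords s) - snd (half_coords s')"
  have "kagome_point v - kagome_point w = (of_int i / 2) *\<^sub>R a1 + (of_int j / 2) *\<^sub>R a2"
    by (cases s; cases s')
      (simp_all add: v w i_def j_def kagome_point_def lattice_vec_def
        algebra_simps add_divide_distrib diff_divide_distrib)
  moreover have "(norm (kagome_point v - kagome_point w))\<^sup>2 = 1 / 4"
    using assms by (simp only: kagome_edge_def dist_norm) (simp add: power_divide)
  ultimately have "real_of_int (i * i + i * j + j * j) / 4 = 1 / 4"
    by (simp only: norm_half_lattice)
  then have "real_of_int (i * i + i * j + j * j) = 1"
    by (simp only: divide_cancel_right) simp
  then have "i * i + i * j + j * j = 1"
    by linarith
  from unit_eisenstein[OF this] show ?thesis
    unfolding v w i_def j_def by (cases s; cases s'; simp; arith)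
qed

section \<open>Flex properties\<close>

lemma row_flex_preserves_edges:
  assumes "kagome_edge v w"
  shows "dist (row_flex S t v) (row_flex S t w) = dist (kagome_point v) (kagome_point w)"
  using kagome_edge_same_triangle[OF assms]
  by (auto simp: dist_norm row_flex_diff_up row_flex_diff_down)

lemma row_flex_zero: "row_flex S 0 = kagome_point"
  by (rule ext) (simp add: row_flex_def kagome_point_def up_motion_def mean_rot_def)

lemma continuous_on_row_flex: "continuous_on T (\<lambda>t. row_flex S t v)"
  unfolding row_flex_def up_motion_def mean_rot_def
  by (cases "snd (fst v) \<in> S") (auto intro!: continuous_intros)

lemma row_flex_fixes_base_triangle:
  assumes "0 \<notin> S"
  shows "row_flex S t ((0, 0), s) = kagome_point ((0, 0), s)"
  using assms
  by (simp add: row_flex_def kagome_point_def lattice_vec_def up_motion_def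
      linear_0[OF linear_mean_rot])

lemma kagome_edge_angle: "kagome_edge ((0, 0), S2) ((0, 0), S1)" "kagome_edge ((0, 0), S1) ((0, -1), S3)"
  by (simp_all add: kagome_edge_def kagome_point_def lattice_vec_def dist_norm
    norm_vec_def L2_set_def sum_2 a1_def a2_def power_divide real_sqrt_divide)

lemma rot_fixed_point:
  assumes "cos t \<noteq> 1" "rot t x = x"
  shows "x = 0"
proof -
  have "(1 - cos t) * (x \<bullet> x) = 0"
    using inner_rot_self[of x t] assms(2) by (simp add: algebra_simps)
  then show ?thesis
    using assms(1) by simp
qed

lemma cos_one_neq_one: "cos (1::real) \<noteq> 1"
  using cos_monotone_0_pi[of 0 "1::real"] pi_gt3 by simp

lemma a1_neq_zero: "a1 \<noteq> 0" and a2_neq_zero: "a2 \<noteq> 0"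
  by (simp_all add: a1_def a2_def vec_eq_iff forall_2)

lemma row_flex_moves: "row_flex S 1 \<noteq> kagome_point"
proof
  assume "row_flex S 1 = kagome_point"
  then have "row_flex S 1 ((1, 0), S3) = kagome_point ((1, 0), S3)"
    by simp
  then have "(1/2) *\<^sub>R (a1 + rot 1 a1) = a1"
    by (simp add: row_flex_def kagome_point_def lattice_vec_def mean_rot_def linear_0[OF linear_up_motion] add.commute)
  then have "2 *\<^sub>R ((1/2) *\<^sub>R (a1 + rot 1 a1)) = 2 *\<^sub>R a1"
    by (rule arg_cong)
  then have "rot 1 a1 = a1"
    by (simp add: scaleR_2 del: scaleR_add_right)
  then show False
    using rot_fixed_point cos_one_neq_one a1_neq_zero by blast
qed

text \<open>In a row on which \<open>S\<close> and \<open>S'\<close> disagree, only one of the flexes turns the side from \<open>S3\<close> to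
  \<open>S1\<close>; the apex \<open>S3\<close> moves in the same way in both.\<close>

lemma row_flex_separates:
  assumes "S \<noteq> S'"
  shows "row_flex S 1 \<noteq> row_flex S' 1"
proof
  assume eq: "row_flex S 1 = row_flex S' 1"
  obtain n where n: "(n \<in> S) \<noteq> (n \<in> S')"
    using assms by blast
  have "row_flex S 1 ((0, n), S1) = row_flex S' 1 ((0, n), S1)"
    by (simp add: eq)
  then have "rot 1 (- site_point S3) = - site_point S3"
    using n by (auto simp: row_flex_def up_motion_def split: if_splits)
  moreover have "- site_point S3 \<noteq> 0"
    by (simp add: a2_neq_zero)
  ultimately show False
    using rot_fixed_point cos_one_neq_one by blast
qed

lemma base_fixed_flex_row_flex:
  assumes "0 \<notin> S"
  shows "base_fixed_flex kagome_edge kagome_point (row_flex S)"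
proof -
  have "\<exists>v w. kagome_edge v w \<and> (\<forall>t\<in>{-1..1}. row_flex S t v = kagome_point v \<and> row_flex S t w = kagome_point w)"
    using kagome_edge_angle(1) row_flex_fixes_base_triangle[OF assms] by blast
  moreover have "\<exists>t\<in>{-1..1}. row_flex S t \<noteq> kagome_point"
    using row_flex_moves by (intro bexI[of _ 1]) auto
  ultimately show ?thesis
    unfolding base_fixed_flex_def
    using row_flex_zero continuous_on_row_flex row_flex_preserves_edges by blast
qed

text \<open>Only horizontal translations preserve the row, and with it the motion of the triangles,
  for arbitrary \<open>S\<close>; hence the rank-one group.\<close>

lemma flow_periodic_row_flex: "flow_periodic (row_flex S)"
proof -
  define D where "D = (UNIV :: int set) \<times> {0 :: int}"
  have "subgroup D (integer_group \<times>\<times> integer_group)"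
    using DirProd_subgroups[OF group_integer_group group.subgroup_self[OF group_integer_group]
        group_integer_group group.triv_subgroup[OF group_integer_group]]
    by (simp add: D_def)
  moreover have "(1, 0) \<in> D"
    by (simp add: D_def)
  then have "D \<noteq> {(0, 0)}"
    by auto
  moreover have "flow_periodic_wrt mean_rot D (row_flex S)"
    unfolding flow_periodic_wrt_def
  proof (intro ballI allI)
    fix t :: real and v g
    assume "t \<in> {-1..1}" and g: "g \<in> D"
    then have c: "cos t > 0"
      using pi_gt3 by (intro cos_gt_zero_pi) auto
    have "shift_vertex g v = (g + fst v, snd v)"
      by (simp add: shift_vertex_def prod_eq_iff)
    moreover have "snd g = 0"
      using g by (simp add: D_def mem_Times_iff)
    ultimately show "row_flex S t (shift_vertex g v)
        = (mean_rot t \<circ> translation g \<circ> inv_into UNIV (mean_rot t)) (row_flex S t v)"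
      unfolding mean_rot_conj_translation[OF c]
      by (simp add: row_flex_def lattice_vec_add linear_add[OF linear_mean_rot])
  qed
  ultimately show ?thesis
    unfolding flow_periodic_def using affine_flow_mean_rot by blast
qed

section \<open>The controlling angle\<close>

text \<open>The two sides of the hexagon start at the angle \<open>2 * pi / 3\<close>, which shrinks by \<open>t\<close>.  With
  the edge of the turning triangle that is collinear with the fixed one, at the angle \<open>pi\<close>,
  the inner product would be even in \<open>t\<close> and therefore not monotone.\<close>

lemma row_flex_angle:
  assumes "0 \<notin> S"
  shows "(row_flex S t ((0, 0), S2) - row_flex S t ((0, 0), S1))
      \<bullet> (row_flex S t ((0, -1), S3) - row_flex S t ((0, 0), S1)) = - cos (t + pi / 3) / 4"
proof -
  have "row_flex S t ((0, 0), S2) - row_flex S t ((0, 0), S1) = (1/2) *\<^sub>R a1"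
    using assms by (simp add: row_flex_diff_up up_motion_def kagome_point_def)
  moreover have half: "(1/2) *\<^sub>R a2 - a2 = - ((1/2) *\<^sub>R a2)"
    by (simp add: vec_eq_iff)
  moreover have "row_flex S t ((0, -1), S3) - row_flex S t ((0, 0), S1) = rot t ((-1/2) *\<^sub>R a2)"
    using assms
    by (simp add: half row_flex_diff_down down_motion_def kagome_point_def lattice_vec_def)
  moreover have "((1/2) *\<^sub>R a1) \<bullet> rot t ((-1/2) *\<^sub>R a2) = - cos (t + pi / 3) / 4"
    by (simp add: rot_def inner_vec_def sum_2 a1_def a2_def cos_add cos_60 sin_60 diff_divide_distrib)
  ultimately show ?thesis
    by simp
qed

text \<open>Since \<open>1 < pi / 3\<close>, the argument of the cosine stays between \<open>0\<close> and \<open>pi\<close>.\<close>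

lemma strict_mono_on_angle: "strict_mono_on {-1..1} (\<lambda>t::real. - cos (t + pi / 3) / 4)"
proof (rule strict_mono_onI)
  fix r s :: real assume "r \<in> {-1..1}" "s \<in> {-1..1}" "r < s"
  then have "cos (s + pi / 3) < cos (r + pi / 3)"
    using pi_gt3 by (intro cos_monotone_0_pi) auto
  then show "- cos (r + pi / 3) / 4 < - cos (s + pi / 3) / 4"
    by simp
qed

section \<open>Uncountably many flexes\<close>

text \<open>If the power set were countable, then \<open>A\<close>, which embeds into it by singletons, would be in
  bijection with the natural numbers, and so an enumeration of the power set would be a
  surjection from \<open>A\<close>, against Cantor.\<close>

lemma uncountable_Pow:
  assumes "infinite A"
  shows "uncountable (Pow A)"
proof
  assume c: "countable (Pow A)"
  have "(\<lambda>x. {x}) ` A \<subseteq> Pow A"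
    by blast
  then have "countable A"
    using countable_subset[OF _ c] countable_image_inj_on[of "\<lambda>x. {x}" A] by (simp add: inj_on_def)
  then have "to_nat_on A ` A = UNIV"
    using assms to_nat_on_infinite bij_betw_imp_surj_on by blast
  then have "(from_nat_into (Pow A) \<circ> to_nat_on A) ` A = Pow A"
    using range_from_nat_into[OF Pow_not_empty c] by (simp only: image_comp[symmetric])
  then show False
    using Cantors_theorem by blast
qed

theorem theorem4p5:
  "\<exists>vi vj vk. kagome_edge vi vj \<and> kagome_edge vj vk \<and>
     (\<exists>F :: (real \<Rightarrow> kvertex \<Rightarrow> real ^ 2) set.
        uncountable F \<and>
        (\<forall>P\<in>F. base_fixed_flex kagome_edge kagome_point P \<and> flow_periodic P) \<and>
        (\<forall>P\<in>F. \<forall>Q\<in>F. P \<noteq> Q \<longrightarrow> different_flexes P Q) \<and>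
        (\<forall>P\<in>F. \<forall>Q\<in>F. \<forall>t\<in>{-1..1}. P t vi = Q t vi \<and> P t vj = Q t vj \<and> P t vk = Q t vk) \<and>
        (\<forall>P\<in>F. let g = (\<lambda>t. (P t vi - P t vj) \<bullet> (P t vk - P t vj)) in
           strict_mono_on {-1..1} g \<or> strict_antimono_on {-1..1} g))"
proof (intro exI conjI)
  let ?I = "Pow (- {0 :: int})"
  let ?F = "row_flex ` ?I"
  show "kagome_edge ((0, 0), S2) ((0, 0), S1)" "kagome_edge ((0, 0), S1) ((0, -1), S3)"
    by (fact kagome_edge_angle)+
  have "inj_on row_flex ?I"
    using row_flex_separates by (metis inj_onI)
  moreover have "infinite (- {0 :: int})"
    using infinite_UNIV_int by (simp add: Compl_eq_Diff_UNIV)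
  ultimately show "uncountable ?F"
    using uncountable_Pow countable_image_inj_on by blast
  show "\<forall>P\<in>?F. base_fixed_flex kagome_edge kagome_point P \<and> flow_periodic P"
    using base_fixed_flex_row_flex flow_periodic_row_flex by auto
  show "\<forall>P\<in>?F. \<forall>Q\<in>?F. P \<noteq> Q \<longrightarrow> different_flexes P Q"
  proof (intro ballI impI)
    fix P Q assume "P \<in> ?F" "Q \<in> ?F" "P \<noteq> Q"
    then have "P 1 \<noteq> Q 1"
      by (metis (no_types, lifting) imageE row_flex_separates)
    then show "different_flexes P Q"
      unfolding different_flexes_def by (intro bexI[of _ 1]) auto
  qed
  have "row_flex S t ((0, -1), S3) = mean_rot t (- a2) + site_point S3" for S t
    by (simp add: row_flex_def lattice_vec_def linear_0[OF linear_up_motion])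
  then show "\<forall>P\<in>?F. \<forall>Q\<in>?F. \<forall>t\<in>{-1..1}. P t ((0, 0), S2) = Q t ((0, 0), S2) \<and>
      P t ((0, 0), S1) = Q t ((0, 0), S1) \<and> P t ((0, -1), S3) = Q t ((0, -1), S3)"
    using row_flex_fixes_base_triangle by auto
  show "\<forall>P\<in>?F. let g = (\<lambda>t. (P t ((0, 0), S2) - P t ((0, 0), S1))
        \<bullet> (P t ((0, -1), S3) - P t ((0, 0), S1))) in
      strict_mono_on {-1..1} g \<or> strict_antimono_on {-1..1} g"
  proof
    fix P assume "P \<in> ?F"
    then obtain S where "P = row_flex S" "0 \<notin> S"
      by auto
    then show "let g = (\<lambda>t. (P t ((0, 0), S2) - P t ((0, 0), S1))
        \<bullet> (P t ((0, -1), S3) - P t ((0, 0), S1))) in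
      strict_mono_on {-1..1} g \<or> strict_antimono_on {-1..1} g"
      using strict_mono_on_angle by (simp add: row_flex_angle)
  qed
qed

end
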